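(* Let $G$ be a finite simple graph embedded in a closed surface and let $\mathcal F\neq \mathcal F(G)$ be a set of even faces of $G$. Then every connected component of the resonance graph $R(G;\mathcal F)$ is an induced cubical graph.
   Context: A closed surface is a compact connected 2-dimensional manifold without boundary; an embedding maps vertices to distinct points and edges to simple arcs joining the points of their end-vertices (arcs meeting only at common end-points). A face of $G$ is the closure of a connected component of $\Sigma\setminus G$; $E(f)$ denotes the set of edges on the boundary of face $f$, and $\mathcal F(G)$ denotes the set of all faces of $G$. A face is even if its boundary is a cycle of even length. For a set $\mathcal F$ of even faces, the resonance graph $R(G;\mathcal F)$ has as vertex set the set of all perfect matchings of $G$, and two perfect matchings $M_1,M_2$ are adjacent iff the symmetric difference $M_1\oplus M_2$ equals $E(f)$ (the boundary cycle of $f$) for some face $f\in\mathcal F$. A graph $H$ is an induced cubical graph if there exist $n\ge 1$ and an injective map $\ell:V(H)\to V(Q_n)$ into the vertex set of the $n$-dimensional hypercube $Q_n$ (binary strings of length $n$, adjacent iff they differ in exactly one position) such that for all $x,y\in V(H)$, $\ell(x)\ell(y)\in E(Q_n)$ if and only if $xy\in E(H)$. *)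

theory Defs
  imports "HOL-Analysis.Analysis"
begin

record 'a sgraph =
  gverts :: "'a set"
  gedges :: "'a set set"

definition simple_graph :: "'a sgraph \<Rightarrow> bool" where
  "simple_graph G \<longleftrightarrow> (\<forall>e\<in>gedges G. e \<subseteq> gverts G \<and> card e = 2)"

definition adjacent :: "'a sgraph \<Rightarrow> 'a \<Rightarrow> 'a \<Rightarrow> bool" where
  "adjacent G x y \<longleftrightarrow> {x, y} \<in> gedges G"

definition induced_subgraph :: "'a sgraph \<Rightarrow> 'a set \<Rightarrow> 'a sgraph" where
  "induced_subgraph G W = \<lparr>gverts = gverts G \<inter> W, gedges = {e \<in> gedges G. e \<subseteq> W}\<rparr>"

definition graph_components :: "'a sgraph \<Rightarrow> 'a sgraph set" where
  "graph_components G = {induced_subgraph G {y. (adjacent G)\<^sup>*\<^sup>* x y} | x. x \<in> gverts G}"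

definition cycle_edges :: "'a list \<Rightarrow> 'a set set" where
  "cycle_edges vs = {{vs ! i, vs ! (Suc i mod length vs)} | i. i < length vs}"

definition is_cycle :: "'a sgraph \<Rightarrow> 'a list \<Rightarrow> bool" where
  "is_cycle G vs \<longleftrightarrow> length vs \<ge> 3 \<and> distinct vs \<and> set vs \<subseteq> gverts G \<and> cycle_edges vs \<subseteq> gedges G"

definition perfect_matching :: "'a sgraph \<Rightarrow> 'a set set \<Rightarrow> bool" where
  "perfect_matching G M \<longleftrightarrow> M \<subseteq> gedges G \<and> (\<forall>v\<in>gverts G. \<exists>!e. e \<in> M \<and> v \<in> e)"

definition hypercube :: "nat \<Rightarrow> bool list sgraph" where
  "hypercube n =
    \<lparr>gverts = {a. length a = n},
     gedges = {{a, b} | a b. length a = n \<and> length b = n \<and> card {i. i < n \<and> a ! i \<noteq> b ! i} = 1}\<rparr>"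

definition induced_cubical :: "'a sgraph \<Rightarrow> bool" where
  "induced_cubical H \<longleftrightarrow>
    (\<exists>n\<ge>1. \<exists>l. inj_on l (gverts H) \<and> l ` gverts H \<subseteq> gverts (hypercube n) \<and>
      (\<forall>x\<in>gverts H. \<forall>y\<in>gverts H. adjacent (hypercube n) (l x) (l y) \<longleftrightarrow> adjacent H x y))"

definition closed_surface :: "'p topology \<Rightarrow> bool" where
  "closed_surface X \<longleftrightarrow>
    topspace X \<noteq> {} \<and> compact_space X \<and> connected_space X \<and>
    Hausdorff_space X \<and> second_countable X \<and>
    (\<forall>x\<in>topspace X. \<exists>U. openin X U \<and> x \<in> U \<and>
      subtopology X U homeomorphic_space (euclidean :: (real ^ 2) topology))"

text \<open>The map \<open>p\<close> places the vertices, and \<open>c e\<close>, restricted to \<open>{0..1}\<close>, parametrises the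
  arc of the edge \<open>e\<close>. The orientation of the parametrisation is irrelevant.\<close>

definition graph_embedding ::
  "'v sgraph \<Rightarrow> 'p topology \<Rightarrow> ('v \<Rightarrow> 'p) \<Rightarrow> ('v set \<Rightarrow> real \<Rightarrow> 'p) \<Rightarrow> bool" where
  "graph_embedding G X p c \<longleftrightarrow>
    p ` gverts G \<subseteq> topspace X \<and> inj_on p (gverts G) \<and>
    (\<forall>e\<in>gedges G. pathin X (c e) \<and> inj_on (c e) {0..1} \<and> {c e 0, c e 1} = p ` e \<and>
      c e ` {0..1} \<inter> p ` gverts G = p ` e) \<and>
    (\<forall>e\<in>gedges G. \<forall>e'\<in>gedges G. e \<noteq> e' \<longrightarrow> c e ` {0..1} \<inter> c e' ` {0..1} \<subseteq> p ` (e \<inter> e'))"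

definition graph_points :: "'v sgraph \<Rightarrow> ('v \<Rightarrow> 'p) \<Rightarrow> ('v set \<Rightarrow> real \<Rightarrow> 'p) \<Rightarrow> 'p set" where
  "graph_points G p c = p ` gverts G \<union> (\<Union>e\<in>gedges G. c e ` {0..1})"

definition faces ::
  "'v sgraph \<Rightarrow> 'p topology \<Rightarrow> ('v \<Rightarrow> 'p) \<Rightarrow> ('v set \<Rightarrow> real \<Rightarrow> 'p) \<Rightarrow> 'p set set" where
  "faces G X p c =
    {X closure_of C | C. C \<in> connected_components_of (subtopology X (topspace X - graph_points G p c))}"

text \<open>A face \<open>f\<close> is the closure of a component \<open>C\<close> of the complement of the graph, and
  \<open>C = f - graph_points G p c\<close> (lemma \<open>face_minus_graph\<close>). The boundary of the face is the frontier
  of \<open>C\<close>. The frontier of \<open>f\<close> itself would miss the edges that have \<open>f\<close> on both sides.\<close>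

definition face_boundary ::
  "'v sgraph \<Rightarrow> 'p topology \<Rightarrow> ('v \<Rightarrow> 'p) \<Rightarrow> ('v set \<Rightarrow> real \<Rightarrow> 'p) \<Rightarrow> 'p set \<Rightarrow> 'p set" where
  "face_boundary G X p c f = X frontier_of (f - graph_points G p c)"

lemma face_minus_graph:
  assumes "C \<in> connected_components_of (subtopology X (topspace X - graph_points G p c))"
  shows "X closure_of C - graph_points G p c = C"
proof -
  let ?S = "topspace X - graph_points G p c"
  have "closedin (subtopology X ?S) C"
    using assms by (rule closedin_connected_components_of)
  moreover have "C \<subseteq> ?S"
    using connected_components_of_subset[OF assms] by auto
  ultimately have "?S \<inter> X closure_of C = C"
    by (metis closure_of_closedin closure_of_subtopology inf.absorb_iff2)
  then show ?thesis
    using closure_of_subset_topspace[of X C] by blast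
qed

definition face_edges ::
  "'v sgraph \<Rightarrow> 'p topology \<Rightarrow> ('v \<Rightarrow> 'p) \<Rightarrow> ('v set \<Rightarrow> real \<Rightarrow> 'p) \<Rightarrow> 'p set \<Rightarrow> 'v set set" where
  "face_edges G X p c f = {e \<in> gedges G. c e ` {0..1} \<subseteq> face_boundary G X p c f}"

definition even_face ::
  "'v sgraph \<Rightarrow> 'p topology \<Rightarrow> ('v \<Rightarrow> 'p) \<Rightarrow> ('v set \<Rightarrow> real \<Rightarrow> 'p) \<Rightarrow> 'p set \<Rightarrow> bool" where
  "even_face G X p c f \<longleftrightarrow> f \<in> faces G X p c \<and>
    (\<exists>vs. is_cycle G vs \<and> even (length vs) \<and>
      face_boundary G X p c f = (\<Union>e\<in>cycle_edges vs. c e ` {0..1}))"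

lemma face_edges_eq_cycle_edges:
  assumes emb: "graph_embedding G X p c" and cyc: "is_cycle G vs"
    and bd: "face_boundary G X p c f = (\<Union>e\<in>cycle_edges vs. c e ` {0..1})"
  shows "face_edges G X p c f = cycle_edges vs"
proof
  show "cycle_edges vs \<subseteq> face_edges G X p c f"
    using cyc bd by (auto simp: face_edges_def is_cycle_def)
  show "face_edges G X p c f \<subseteq> cycle_edges vs"
  proof
    fix e assume "e \<in> face_edges G X p c f"
    then have e: "e \<in> gedges G" and sub: "c e ` {0..1} \<subseteq> (\<Union>e\<in>cycle_edges vs. c e ` {0..1})"
      using bd by (auto simp: face_edges_def)
    have half: "c e (1/2) \<in> c e ` {0..1}" by auto
    then obtain e' where e': "e' \<in> cycle_edges vs" "c e (1/2) \<in> c e' ` {0..1}"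
      using sub by blast
    have "e' \<in> gedges G" using e' cyc by (auto simp: is_cycle_def)
    have "e = e'"
    proof (rule ccontr)
      assume "e \<noteq> e'"
      then have "c e (1/2) \<in> p ` (e \<inter> e')"
        using emb e \<open>e' \<in> gedges G\<close> half e'(2) unfolding graph_embedding_def by blast
      then have "c e (1/2) \<in> {c e 0, c e 1}"
        using emb e unfolding graph_embedding_def by blast
      moreover have "inj_on (c e) {0..1}"
        using emb e unfolding graph_embedding_def by blast
      ultimately show False
        by (auto dest: inj_onD)
    qed
    with e' show "e \<in> cycle_edges vs" by simp
  qed
qed

definition resonance_graph ::
  "'v sgraph \<Rightarrow> 'p topology \<Rightarrow> ('v \<Rightarrow> 'p) \<Rightarrow> ('v set \<Rightarrow> real \<Rightarrow> 'p) \<Rightarrow> 'p set set \<Rightarrow> 'v set set sgraph" where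
  "resonance_graph G X p c F =
    \<lparr>gverts = {M. perfect_matching G M},
     gedges = {{M1, M2} | M1 M2. perfect_matching G M1 \<and> perfect_matching G M2 \<and>
       (\<exists>f\<in>F. sym_diff M1 M2 = face_edges G X p c f)}\<rparr>"

end

theory Submission
  imports Defs "HOL-Complex_Analysis.Contour_Integration"
begin

text \<open>The edge sets \<open>E(f)\<close> of the faces in \<open>F\<close> are linearly independent over \<open>GF(2)\<close>: if every
  edge were on an even number of faces of a nonempty finite \<open>S \<subseteq> F\<close>, then, as an edge has at
  most two sides, both sides of each edge on a face of \<open>S\<close> would belong to \<open>\<Union>S\<close>, so that
  \<open>\<Union>S\<close> would be open and closed in the surface, and \<open>S\<close> would consist of all faces. In a component
  of the resonance graph with base point \<open>M\<close>, each \<open>M \<oplus> A\<close> is thus the sum of a unique set of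
  boundaries \<open>E(f)\<close>, \<open>f \<in> F\<close>, and the indicator vector of this set is the label of \<open>A\<close>.\<close>

subsection \<open>Crosscuts of plane discs\<close>

lemma interval_in_open_preimage:
  fixes g :: "real \<Rightarrow> 'a::topological_space"
  assumes g: "continuous_on {a..b} g" and S: "open S"
    and t: "t \<in> {a..b}" "g t \<in> S" and ends: "g a \<notin> S" "g b \<notin> S"
  obtains u v where "a \<le> u" "u < t" "t < v" "v \<le> b"
    "g u \<in> frontier S" "g v \<in> frontier S" "g ` {u<..<v} \<subseteq> S"
proof -
  have compact_exits: "compact ({c..d} \<inter> g -` (- S))" if "{c..d} \<subseteq> {a..b}" for c d
    by (rule closedin_compact[OF compact_Icc
          continuous_closedin_preimage[OF continuous_on_subset[OF g that] closed_Compl[OF S]]])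
  have "a \<in> {a..t} \<inter> g -` (- S)" "b \<in> {t..b} \<inter> g -` (- S)"
    using t ends by simp_all
  then have nonempty: "{a..t} \<inter> g -` (- S) \<noteq> {}" "{t..b} \<inter> g -` (- S) \<noteq> {}"
    by blast+
  have "{a..t} \<subseteq> {a..b}" "{t..b} \<subseteq> {a..b}"
    using t(1) by simp_all
  note exits = this[THEN compact_exits]
  obtain u where u: "u \<in> {a..t} \<inter> g -` (- S)" "\<forall>s\<in>{a..t} \<inter> g -` (- S). s \<le> u"
    using compact_attains_sup[OF exits(1) nonempty(1)] by blast
  obtain v where v: "v \<in> {t..b} \<inter> g -` (- S)" "\<forall>s\<in>{t..b} \<inter> g -` (- S). v \<le> s"
    using compact_attains_inf[OF exits(2) nonempty(2)] by blast
  have uv: "u < t" "t < v"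
    using u(1) v(1) t(2) by (auto simp: less_le)
  have inside: "g ` {u<..<v} \<subseteq> S"
  proof (rule image_subsetI, rule ccontr)
    fix s assume s: "s \<in> {u<..<v}" "g s \<notin> S"
    then have "s \<in> {a..t} \<inter> g -` (- S) \<or> s \<in> {t..b} \<inter> g -` (- S)"
      using u(1) v(1) by auto
    then have "s \<le> u \<or> v \<le> s"
      using u(2) v(2) by blast
    then show False
      using s(1) by simp
  qed
  have "g ` closure {u<..<v} \<subseteq> closure S"
    using u(1) v(1) uv inside closure_subset[of S]
    by (intro image_closure_subset continuous_on_subset[OF g]) auto
  then have "g u \<in> frontier S" "g v \<in> frontier S"
    using u(1) v(1) uv S by (auto simp: frontier_def interior_open)
  then show thesis
    using that[of u v] u(1) v(1) uv inside by auto
qed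

lemma arc_subpath_inj_on:
  fixes g :: "real \<Rightarrow> 'a::real_normed_vector"
  assumes "continuous_on {a..b} g" "inj_on g {a..b}" "a < b"
  shows "arc (subpath a b g)"
proof -
  have "continuous_on {0..1} (\<lambda>x. g ((b - a) * x + a))"
    using assms(1,3)
    by (intro continuous_on_compose2[OF assms(1)] continuous_intros)
      (simp add: image_affinity_atLeastAtMost)
  then have "path (subpath a b g)"
    by (simp add: path_def subpath_def)
  then show ?thesis
    using assms by (simp add: arc_subpath_eq closed_segment_eq_real_ivl)
qed

lemma connected_inside_two_arcs:
  fixes g h :: "real \<Rightarrow> complex"
  assumes "arc g" "arc h" "pathstart h = pathstart g" "pathfinish h = pathfinish g"
    and "path_image g \<inter> path_image h = {pathstart g, pathfinish g}"
  shows "connected (inside (path_image g \<union> path_image h))"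
proof -
  have "simple_path (g +++ reversepath h)"
    using assms by (simp add: simple_path_join_loop_eq arc_reversepath)
  moreover have "path_image (g +++ reversepath h) = path_image g \<union> path_image h"
    using assms by (simp add: path_image_join)
  ultimately show ?thesis
    using Jordan_inside_outside[of "g +++ reversepath h"] assms(3) by simp
qed

lemma crosscut_inside_Jordan_curve:
  fixes c g :: "real \<Rightarrow> complex"
  assumes c: "simple_path c" "pathfinish c = pathstart c" and "arc g"
    and ends: "pathstart g \<in> path_image c" "pathfinish g \<in> path_image c"
    and inner: "path_image g - {pathstart g, pathfinish g} \<subseteq> inside (path_image c)"
  obtains A B where "connected A" "connected B" "inside (path_image c) - path_image g = A \<union> B"
proof -
  let ?a = "pathstart g" and ?b = "pathfinish g"
  obtain u d' where u: "arc u" "pathstart u = ?a" "pathfinish u = ?b"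
    and d': "arc d'" "pathstart d' = ?b" "pathfinish d' = ?a"
    and ud': "path_image u \<inter> path_image d' = {?a, ?b}" "path_image u \<union> path_image d' = path_image c"
    using exists_double_arc[OF c ends arc_distinct_ends[OF \<open>arc g\<close>, symmetric]] .
  define d where "d = reversepath d'"
  have d: "arc d" "pathstart d = ?a" "pathfinish d = ?b"
    using d' by (simp_all add: d_def arc_reversepath)
  have ud: "path_image u \<inter> path_image d = {?a, ?b}" "path_image u \<union> path_image d = path_image c"
    using ud' by (simp_all add: d_def)
  have disjoint: "inside (path_image c) \<inter> path_image c = {}"
    by (rule inside_no_overlap)
  have ends_g: "?a \<in> path_image g" "?b \<in> path_image g"
    by (rule pathstart_in_path_image, rule pathfinish_in_path_image)
  have ug: "path_image u \<inter> path_image g = {?a, ?b}" and dg: "path_image d \<inter> path_image g = {?a, ?b}"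
    using inner disjoint ud ends_g by blast+
  have "g (1/2) \<in> path_image g - {?a, ?b}"
    using \<open>arc g\<close> by (auto simp: path_image_def pathstart_def pathfinish_def arc_def dest: inj_onD)
  then have "path_image g \<inter> inside (path_image u \<union> path_image d) \<noteq> {}"
    using inner unfolding ud(2) by blast
  then have split: "inside (path_image u \<union> path_image g) \<union> inside (path_image d \<union> path_image g)
      \<union> (path_image g - {?a, ?b}) = inside (path_image c)"
    using split_inside_simple_closed_curve[of u ?a ?b d g] \<open>arc g\<close> u d ud(1) ug dg
    unfolding ud(2) by (metis arc_distinct_ends arc_imp_simple_path)
  have "inside (path_image u \<union> path_image g) \<inter> path_image g = {}"
    "inside (path_image d \<union> path_image g) \<inter> path_image g = {}"
    using inside_no_overlap by blast+
  then have "inside (path_image c) - path_image g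
      = inside (path_image u \<union> path_image g) \<union> inside (path_image d \<union> path_image g)"
    using split disjoint ends by blast
  then show thesis
    using that connected_inside_two_arcs[OF u(1) \<open>arc g\<close>] connected_inside_two_arcs[OF d(1) \<open>arc g\<close>]
      u d ug dg by metis
qed

lemma disc_crosscut_through_arc_point:
  fixes g :: "real \<Rightarrow> complex"
  assumes g: "continuous_on {a..b} g" "inj_on g {a..b}" and t: "t \<in> {a..b}"
    and r: "0 < r" "r \<le> dist (g t) (g a)" "r \<le> dist (g t) (g b)"
  obtains u v A B where "a \<le> u" "u < t" "t < v" "v \<le> b"
    "g u \<in> sphere (g t) r" "g v \<in> sphere (g t) r"
    "connected A" "connected B" "ball (g t) r - g ` {u..v} = A \<union> B"
proof -
  obtain u v where uv: "a \<le> u" "u < t" "t < v" "v \<le> b"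
    and frontier: "g u \<in> frontier (ball (g t) r)" "g v \<in> frontier (ball (g t) r)"
    and inside: "g ` {u<..<v} \<subseteq> ball (g t) r"
    using interval_in_open_preimage[OF g(1) open_ball t, of "g t" r] r by auto
  have sphere: "g u \<in> sphere (g t) r" "g v \<in> sphere (g t) r"
    using frontier r(1) by simp_all
  define h where "h = subpath u v g"
  have h: "pathstart h = g u" "pathfinish h = g v" "path_image h = g ` {u..v}"
    using uv by (simp_all add: h_def path_image_subpath)
  have "arc h"
    unfolding h_def using uv
    by (intro arc_subpath_inj_on continuous_on_subset[OF g(1)] inj_on_subset[OF g(2)]) auto
  have disc: "inside (path_image (circlepath (g t) r)) = ball (g t) r"
    using inside_frontier_eq_interior[of "cball (g t) r"] r(1) by simp
  have "{u..v} = insert u (insert v {u<..<v})"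
    using uv by auto
  then have inner:
    "path_image h - {pathstart h, pathfinish h} \<subseteq> inside (path_image (circlepath (g t) r))"
    using inside unfolding disc h by auto
  have "pathstart h \<in> path_image (circlepath (g t) r)" "pathfinish h \<in> path_image (circlepath (g t) r)"
    using sphere r(1) h by simp_all
  then obtain A B where "connected A" "connected B" "ball (g t) r - g ` {u..v} = A \<union> B"
    using crosscut_inside_Jordan_curve[OF _ _ \<open>arc h\<close> _ _ inner] r(1) h(3) disc
    by (metis simple_path_circlepath pathstart_circlepath pathfinish_circlepath less_irrefl)
  then show thesis
    using that uv sphere by blast
qed

text \<open>Adding the circle to both sets makes their intersection the circle, which is connected, so
  that Janiszewski's theorem applies.\<close>

lemma connected_component_disc_diff_Un:
  fixes w w' :: complex
  assumes K: "compact K" and L: "closed L" and KL: "K \<inter> L \<subseteq> sphere z r"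
    and cc: "connected_component (ball z r - K) w w'" "connected_component (ball z r - L) w w'"
  shows "connected_component (ball z r - (K \<union> L)) w w'"
proof -
  have avoid: "connected_component (- (S \<union> sphere z r)) w w'"
    if "connected_component (ball z r - S) w w'" for S
    using that by (rule connected_component_of_subset) auto
  have "(K \<union> sphere z r) \<inter> (L \<union> sphere z r) = sphere z r"
    using KL by blast
  then have "connected ((K \<union> sphere z r) \<inter> (L \<union> sphere z r))"
    by (simp add: connected_sphere DIM_complex)
  then have "connected_component (- ((K \<union> sphere z r) \<union> (L \<union> sphere z r))) w w'"
    using K L by (intro Janiszewski avoid cc) (simp_all add: compact_Un closed_Un)
  then obtain D where D: "connected D" "w \<in> D" "w' \<in> D" "D \<inter> (K \<union> L) = {}" "D \<inter> sphere z r = {}"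
    unfolding connected_component_def by blast
  have w: "w \<in> ball z r"
    using connected_component_in(1)[OF cc(1)] by blast
  then have "0 < r"
    by (metis ball_eq_empty empty_iff not_le)
  then have "D \<inter> frontier (ball z r) = {}"
    using D(5) by simp
  then have "D \<subseteq> ball z r"
    using connected_Int_frontier[OF D(1), of "ball z r"] D(2) w by blast
  then show ?thesis
    unfolding connected_component_def using D by blast
qed

lemma connected_set_between:
  assumes "\<And>x y. x \<in> N \<Longrightarrow> y \<in> N \<Longrightarrow> connected_component S x y"
  obtains C where "connected C" "N \<subseteq> C" "C \<subseteq> S"
proof (cases "N = {}")
  case True
  then show thesis
    using that[of "{}"] by simp
next
  case False
  then obtain x where "x \<in> N"
    by blast
  then have "N \<subseteq> connected_component_set S x"
    using assms by blast
  then show thesis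
    using that connected_connected_component connected_component_subset by blast
qed

lemma connected_set_in_disc_diff_Un:
  fixes z :: complex
  assumes KL: "compact K" "closed L" "K \<inter> L \<subseteq> sphere z r"
    and C: "connected C" "C \<subseteq> ball z r - K" and N: "connected N" "N \<subseteq> ball z r - L"
  obtains D where "connected D" "C \<inter> N \<subseteq> D" "D \<subseteq> ball z r - (K \<union> L)"
proof (rule connected_set_between)
  fix w w' assume "w \<in> C \<inter> N" "w' \<in> C \<inter> N"
  then have "connected_component (ball z r - K) w w'" "connected_component (ball z r - L) w w'"
    using C N unfolding connected_component_def by blast+
  then show "connected_component (ball z r - (K \<union> L)) w w'"
    by (rule connected_component_disc_diff_Un[OF KL])
qed

lemma arc_remainder:
  fixes g :: "real \<Rightarrow> 'a::t2_space"
  assumes g: "continuous_on {a..b} g" "inj_on g {a..b}"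
    and uv: "a \<le> u" "u < t" "t < v" "v \<le> b"
  obtains L where "closed L" "g ` {a..b} = g ` {u..v} \<union> L" "g ` {u..v} \<inter> L = {g u, g v}" "g t \<notin> L"
proof
  let ?R = "{a..u} \<union> {v..b}"
  show "closed (g ` ?R)"
    using uv
    by (auto intro!: compact_imp_closed compact_continuous_image continuous_on_subset[OF g(1)])
  have "{a..b} = {u..v} \<union> ?R"
    using uv by auto
  then show "g ` {a..b} = g ` {u..v} \<union> g ` ?R"
    by (metis image_Un)
  have "g ` {u..v} \<inter> g ` ?R = g ` ({u..v} \<inter> ?R)"
    using uv by (intro inj_on_image_Int[OF g(2), symmetric]) auto
  also have "{u..v} \<inter> ?R = {u, v}"
    using uv by auto
  finally show "g ` {u..v} \<inter> g ` ?R = {g u, g v}"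
    by simp
  show "g t \<notin> g ` ?R"
    using inj_on_image_mem_iff[OF g(2), of t ?R] uv by auto
qed

lemma plane_arc_sides_in_disc:
  fixes g :: "real \<Rightarrow> complex"
  assumes g: "continuous_on {a..b} g" "inj_on g {a..b}" and t: "t \<in> {a..b}"
    and r: "0 < r" "r \<le> dist (g t) (g a)" "r \<le> dist (g t) (g b)"
  obtains \<delta> A B where "0 < \<delta>" "\<delta> \<le> r" "connected A" "connected B"
    "ball (g t) \<delta> - g ` {a..b} \<subseteq> A \<union> B" "A \<union> B \<subseteq> ball (g t) r - g ` {a..b}"
proof -
  obtain u v A B where uv: "a \<le> u" "u < t" "t < v" "v \<le> b"
    and sphere: "g u \<in> sphere (g t) r" "g v \<in> sphere (g t) r"
    and AB: "connected A" "connected B" "ball (g t) r - g ` {u..v} = A \<union> B"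
    using disc_crosscut_through_arc_point[OF g t r] .
  obtain L where L: "closed L" "g ` {a..b} = g ` {u..v} \<union> L" "g ` {u..v} \<inter> L = {g u, g v}" "g t \<notin> L"
    using arc_remainder[OF g uv] .
  obtain \<delta>0 where \<delta>0: "0 < \<delta>0" "ball (g t) \<delta>0 \<subseteq> - L"
    using L(1,4) by (metis openE open_Compl ComplI)
  define \<delta> where "\<delta> = min \<delta>0 r"
  have \<delta>: "0 < \<delta>" "\<delta> \<le> r" "ball (g t) \<delta> \<subseteq> ball (g t) r - L"
    using \<delta>0 r(1) by (auto simp: \<delta>_def)
  have "compact (g ` {u..v})"
    using uv by (intro compact_continuous_image continuous_on_subset[OF g(1)]) auto
  moreover have "g ` {u..v} \<inter> L \<subseteq> sphere (g t) r"
    using L(3) sphere by simp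
  ultimately have side: "\<exists>D. connected D \<and> C \<inter> ball (g t) \<delta> \<subseteq> D \<and> D \<subseteq> ball (g t) r - g ` {a..b}"
    if "connected C" "C \<subseteq> ball (g t) r - g ` {u..v}" for C
    using connected_set_in_disc_diff_Un[OF _ L(1) _ that connected_ball \<delta>(3)] unfolding L(2) by metis
  obtain A' where A': "connected A'" "A \<inter> ball (g t) \<delta> \<subseteq> A'" "A' \<subseteq> ball (g t) r - g ` {a..b}"
    using side[OF AB(1)] AB(3) by auto
  obtain B' where B': "connected B'" "B \<inter> ball (g t) \<delta> \<subseteq> B'" "B' \<subseteq> ball (g t) r - g ` {a..b}"
    using side[OF AB(2)] AB(3) by auto
  have "ball (g t) \<delta> - g ` {a..b} \<subseteq> A' \<union> B'"
    using A'(2) B'(2) AB(3) \<delta>(3) unfolding L(2) by blast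
  then show thesis
    using that \<delta>(1,2) A'(1,3) B'(1,3) by blast
qed

subsection \<open>Points of a set with at most two local sides\<close>

definition at_most_two_sides_at :: "'a topology \<Rightarrow> 'a set \<Rightarrow> 'a \<Rightarrow> bool" where
  "at_most_two_sides_at X K x \<longleftrightarrow>
    (\<forall>U. openin X U \<and> x \<in> U \<longrightarrow>
      (\<exists>N A B. openin X N \<and> x \<in> N \<and> N \<subseteq> U \<and> connectedin X A \<and> connectedin X B \<and>
        N - K \<subseteq> A \<union> B \<and> A \<union> B \<subseteq> U - K))"

lemma at_most_two_sides_at_cong_open:
  assumes K: "at_most_two_sides_at X K x" and V: "openin X V" "x \<in> V" "K \<inter> V = K' \<inter> V"
  shows "at_most_two_sides_at X K' x"
  unfolding at_most_two_sides_at_def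
proof (intro allI impI)
  fix U assume "openin X U \<and> x \<in> U"
  then have "openin X (U \<inter> V)" "x \<in> U \<inter> V"
    using V by blast+
  with K obtain N A B where "openin X N" "x \<in> N" "N \<subseteq> U \<inter> V" "connectedin X A" "connectedin X B"
    "N - K \<subseteq> A \<union> B" "A \<union> B \<subseteq> U \<inter> V - K"
    unfolding at_most_two_sides_at_def by meson
  moreover from this have "N - K' \<subseteq> A \<union> B" "A \<union> B \<subseteq> U - K'"
    using V(3) by blast+
  ultimately show "\<exists>N A B. openin X N \<and> x \<in> N \<and> N \<subseteq> U \<and> connectedin X A \<and> connectedin X B \<and>
      N - K' \<subseteq> A \<union> B \<and> A \<union> B \<subseteq> U - K'"
    by blast
qed

lemma at_most_two_sides_at_open_map_image:
  assumes h: "continuous_map Y X h" "open_map Y X h" and y: "y \<in> topspace Y"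
    and K: "at_most_two_sides_at Y {w \<in> topspace Y. h w \<in> K} y"
  shows "at_most_two_sides_at X K (h y)"
  unfolding at_most_two_sides_at_def
proof (intro allI impI)
  fix U assume "openin X U \<and> h y \<in> U"
  then have "openin Y {w \<in> topspace Y. h w \<in> U}" "y \<in> {w \<in> topspace Y. h w \<in> U}"
    using openin_continuous_map_preimage[OF h(1)] y by auto
  with K obtain N A B where N: "openin Y N" "y \<in> N" "N \<subseteq> {w \<in> topspace Y. h w \<in> U}"
    and AB: "connectedin Y A" "connectedin Y B"
      "N - {w \<in> topspace Y. h w \<in> K} \<subseteq> A \<union> B"
      "A \<union> B \<subseteq> {w \<in> topspace Y. h w \<in> U} - {w \<in> topspace Y. h w \<in> K}"
    unfolding at_most_two_sides_at_def by meson
  have "openin X (h ` N)" "connectedin X (h ` A)" "connectedin X (h ` B)"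
    using h N AB by (auto simp: open_map_def intro: connectedin_continuous_map_image)
  moreover have "h y \<in> h ` N" "h ` N \<subseteq> U" "h ` N - K \<subseteq> h ` A \<union> h ` B" "h ` A \<union> h ` B \<subseteq> U - K"
    using N AB by blast+
  ultimately show "\<exists>N A B. openin X N \<and> h y \<in> N \<and> N \<subseteq> U \<and> connectedin X A \<and> connectedin X B \<and>
      N - K \<subseteq> A \<union> B \<and> A \<union> B \<subseteq> U - K"
    by blast
qed

lemma at_most_two_sides_at_plane_arc:
  fixes g :: "real \<Rightarrow> complex"
  assumes g: "continuous_on {a..b} g" "inj_on g {a..b}" and t: "a < t" "t < b"
  shows "at_most_two_sides_at euclidean (g ` {a..b}) (g t)"
  unfolding at_most_two_sides_at_def
proof (intro allI impI)
  fix V assume "openin euclidean V \<and> g t \<in> V"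
  then obtain r0 where r0: "0 < r0" "ball (g t) r0 \<subseteq> V"
    using openE by auto
  define r where "r = Min {r0, dist (g t) (g a), dist (g t) (g b)}"
  have "g t \<noteq> g a" "g t \<noteq> g b"
    using inj_on_eq_iff[OF g(2)] t by auto
  then have r: "0 < r" "r \<le> r0" "r \<le> dist (g t) (g a)" "r \<le> dist (g t) (g b)"
    using r0 by (auto simp: r_def)
  have "t \<in> {a..b}"
    using t by simp
  then obtain \<delta> A B where \<delta>: "0 < \<delta>" "\<delta> \<le> r" and AB: "connected A" "connected B"
    "ball (g t) \<delta> - g ` {a..b} \<subseteq> A \<union> B" "A \<union> B \<subseteq> ball (g t) r - g ` {a..b}"
    using plane_arc_sides_in_disc[OF g _ r(1,3,4)] by metis
  have "ball (g t) r \<subseteq> V"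
    using r0(2) subset_ball[OF r(2), of "g t"] by blast
  then have "ball (g t) \<delta> \<subseteq> V" "A \<union> B \<subseteq> V - g ` {a..b}"
    using subset_ball[OF \<delta>(2), of "g t"] AB(4) by blast+
  then show "\<exists>N A B. openin euclidean N \<and> g t \<in> N \<and> N \<subseteq> V \<and> connectedin euclidean A \<and>
      connectedin euclidean B \<and> N - g ` {a..b} \<subseteq> A \<union> B \<and> A \<union> B \<subseteq> V - g ` {a..b}"
    using \<delta>(1) AB(1-3)
    by (intro exI[of _ "ball (g t) \<delta>"] exI[of _ A] exI[of _ B] conjI) simp_all
qed

subsection \<open>Plane charts\<close>

definition plane_chart :: "'p topology \<Rightarrow> (complex \<Rightarrow> 'p) \<Rightarrow> bool" where
  "plane_chart X k \<longleftrightarrow> continuous_map euclidean X k \<and> open_map euclidean X k \<and> inj k"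

lemma closed_surface_chart:
  assumes "closed_surface X" "x \<in> topspace X"
  obtains k where "plane_chart X k" "x \<in> range k"
proof -
  obtain U where U: "openin X U" "x \<in> U"
    "subtopology X U homeomorphic_space (euclidean :: (real ^ 2) topology)"
    using assms unfolding closed_surface_def by blast
  have "(UNIV :: complex set) homeomorphic (UNIV :: (real ^ 2) set)"
    by (simp add: homeomorphic_UNIV_UNIV)
  then have "(euclidean :: complex topology) homeomorphic_space (euclidean :: (real ^ 2) topology)"
    by (auto simp: homeomorphic_def homeomorphism_def homeomorphic_space_def homeomorphic_maps_def)
  then have "(euclidean :: complex topology) homeomorphic_space subtopology X U"
    using U(3) homeomorphic_space_sym homeomorphic_space_trans by blast
  then obtain k where k: "homeomorphic_map (euclidean :: complex topology) (subtopology X U) k"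
    unfolding homeomorphic_space by blast
  then have "range k = U" "inj k"
    using openin_subset[OF U(1)] by (auto simp: homeomorphic_map_def quotient_map_def)
  moreover have "continuous_map euclidean X k"
    using homeomorphic_imp_continuous_map[OF k] by (simp add: continuous_map_in_subtopology)
  moreover have "open_map euclidean X k"
    using homeomorphic_imp_open_map[OF k] openin_open_subtopology[OF U(1)] by (auto simp: open_map_def)
  ultimately show thesis
    using that U(2) by (simp add: plane_chart_def)
qed

context
  fixes X :: "'p topology" and k :: "complex \<Rightarrow> 'p"
  assumes chart: "plane_chart X k"
begin

lemma plane_chart_inv: "inv k (k w) = w"
  using chart by (simp add: plane_chart_def)

lemma openin_plane_chart_image: "open S \<Longrightarrow> openin X (k ` S)"
  using chart by (simp add: plane_chart_def open_map_def)

lemma open_plane_chart_vimage: "openin X S \<Longrightarrow> open (k -` S)"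
  using chart openin_continuous_map_preimage[of euclidean X k S]
  by (simp add: plane_chart_def vimage_def)

lemma closed_plane_chart_vimage: "closedin X S \<Longrightarrow> closed (k -` S)"
  using chart closedin_continuous_map_preimage[of euclidean X k S]
  by (simp add: plane_chart_def vimage_def)

lemma connectedin_plane_chart_image: "connected S \<Longrightarrow> connectedin X (k ` S)"
  using chart connectedin_continuous_map_image[of euclidean X k S] by (simp add: plane_chart_def)

lemma continuous_map_plane_chart_inv: "continuous_map (subtopology X (range k)) euclidean (inv k)"
proof -
  have "{x \<in> topspace (subtopology X (range k)). inv k x \<in> S} = k ` S" if "open S" for S
    using openin_subset[OF openin_plane_chart_image[OF that]] by (auto simp: plane_chart_inv)
  then show ?thesis
    unfolding continuous_map_def openin_open_subtopology[OF openin_plane_chart_image[OF open_UNIV]]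
    using openin_plane_chart_image by auto
qed

lemma plane_chart_inv_arc:
  assumes \<gamma>: "pathin X \<gamma>" "inj_on \<gamma> {0..1}" and T: "T \<subseteq> {0..1}" "\<gamma> ` T \<subseteq> range k"
  shows "continuous_on T (inv k \<circ> \<gamma>)" "inj_on (inv k \<circ> \<gamma>) T" "(inv k \<circ> \<gamma>) ` T = k -` (\<gamma> ` T)"
proof -
  have "continuous_map (top_of_set T) X \<gamma>"
    using \<gamma>(1) T(1) continuous_map_from_subtopology_mono unfolding pathin_def by blast
  then have "continuous_map (top_of_set T) (subtopology X (range k)) \<gamma>"
    using T(2) by (simp add: continuous_map_in_subtopology image_subset_iff_funcset)
  then have "continuous_map (top_of_set T) euclidean (inv k \<circ> \<gamma>)"
    using continuous_map_plane_chart_inv by (rule continuous_map_compose)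
  then show "continuous_on T (inv k \<circ> \<gamma>)"
    by simp
  show "inj_on (inv k \<circ> \<gamma>) T"
    using comp_inj_on[OF inj_on_subset[OF \<gamma>(2) T(1)] inj_on_inv_into[OF T(2)]] .
  have "\<gamma> ` T = k ` (k -` (\<gamma> ` T))"
    using T(2) by (simp add: image_vimage_eq inf.absorb1)
  then have "inv k ` (\<gamma> ` T) = k -` (\<gamma> ` T)"
    using chart image_inv_f_f[of k] unfolding plane_chart_def by metis
  then show "(inv k \<circ> \<gamma>) ` T = k -` (\<gamma> ` T)"
    by (simp add: image_comp)
qed

end

lemma locally_connected_closed_surface:
  assumes "closed_surface X"
  shows "locally_connected_space X"
  unfolding locally_connected_space
proof (intro allI impI)
  fix V x assume V: "openin X V \<and> x \<in> V"
  then obtain k where k: "plane_chart X k" "x \<in> range k"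
    using closed_surface_chart[OF assms] openin_subset by blast
  then obtain z where z: "x = k z"
    by blast
  then obtain r where "0 < r" "ball z r \<subseteq> k -` V"
    using open_plane_chart_vimage[OF k(1)] V openE by (metis vimageI)
  then have "openin X (k ` ball z r)" "connectedin X (k ` ball z r)"
    "x \<in> k ` ball z r" "k ` ball z r \<subseteq> V"
    using openin_plane_chart_image[OF k(1)] connectedin_plane_chart_image[OF k(1)] z by auto
  then show "\<exists>U. openin X U \<and> connectedin X U \<and> x \<in> U \<and> U \<subseteq> V"
    by blast
qed

lemma closed_open_off_finite_eq_UNIV:
  fixes C :: "'a::euclidean_space set"
  assumes dim: "2 \<le> DIM('a)" and C: "closed C" and P: "finite P" "C - P \<subseteq> interior C" "C - P \<noteq> {}"
  shows "C = UNIV"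
proof -
  have "connected (- P)"
    using connected_open_delete_finite[OF open_UNIV connected_UNIV dim P(1)]
    by (simp add: Compl_eq_Diff_UNIV)
  moreover have "C - P = - P \<inter> interior C" "C - P = - P \<inter> C"
    using P(2) interior_subset by blast+
  then have "openin (top_of_set (- P)) (C - P)" "closedin (top_of_set (- P)) (C - P)"
    using C by (metis openin_open_Int open_interior, metis closedin_closed_Int)
  ultimately have "C - P = - P"
    using P(3) unfolding connected_clopen by blast
  then have "- C \<subseteq> P"
    by blast
  then have "finite (- C)"
    using P(1) finite_subset by blast
  then have "- C = {}"
    using finite_imp_not_open open_Compl[OF C] by blast
  then show ?thesis
    by blast
qed

lemma closedin_open_off_finite_eq_topspace:
  assumes X: "closed_surface X" and C: "closedin X C" "C \<noteq> {}"
    and P: "finite P" "C - P \<subseteq> X interior_of C" "C \<subseteq> X closure_of (C - P)"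
  shows "C = topspace X"
proof -
  have "\<exists>U. openin X U \<and> x \<in> U \<and> U \<subseteq> C" if x: "x \<in> C" for x
  proof -
    obtain k where k: "plane_chart X k" "x \<in> range k"
      using closed_surface_chart[OF X] closedin_subset[OF C(1)] x by blast
    have range: "openin X (range k)"
      using openin_plane_chart_image[OF k(1)] by simp
    have "k -` C = UNIV"
    proof (rule closed_open_off_finite_eq_UNIV)
      show "closed (k -` C)"
        by (rule closed_plane_chart_vimage[OF k(1) C(1)])
      show "finite (k -` P)"
        using k(1) P(1) by (intro finite_vimageI) (simp_all add: plane_chart_def)
      have "k -` (X interior_of C) \<subseteq> interior (k -` C)"
        using open_plane_chart_vimage[OF k(1)]
        by (intro interior_maximal vimage_mono interior_of_subset) simp
      then show "k -` C - k -` P \<subseteq> interior (k -` C)"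
        using P(2) by blast
      have "x \<in> X closure_of (C - P)"
        using P(3) x by blast
      then have "(C - P) \<inter> range k \<noteq> {}"
        using range k(2) unfolding in_closure_of by blast
      then show "k -` C - k -` P \<noteq> {}"
        by blast
    qed (simp add: DIM_complex)
    then show ?thesis
      using range k(2) by blast
  qed
  then have "openin X C"
    using openin_subopen by blast
  then show ?thesis
    using X C unfolding closed_surface_def connected_space_clopen_in by blast
qed

lemma closedin_path_image_compact:
  assumes "Hausdorff_space X" "pathin X \<gamma>" "compact T" "T \<subseteq> {0..1}"
  shows "closedin X (\<gamma> ` T)"
proof (rule compactin_imp_closedin[OF assms(1)], rule image_compactin)
  show "compactin (top_of_set {0..1}) T"
    using assms by (simp add: compactin_subtopology)
  show "continuous_map (top_of_set {0..1}) X \<gamma>"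
    using assms by (simp add: pathin_def)
qed

lemma pathin_subinterval_in_open:
  assumes \<gamma>: "pathin X \<gamma>" and U: "openin X U" and t: "0 < t" "t < 1" "\<gamma> t \<in> U"
  obtains a b where "0 < a" "a < t" "t < b" "b < 1" "\<gamma> ` {a..b} \<subseteq> U"
proof -
  let ?T = "{s \<in> {0..1}. \<gamma> s \<in> U} \<inter> {0<..<1}"
  have "openin (top_of_set {0..1}) {s \<in> {0..1}. \<gamma> s \<in> U}"
    using \<gamma> openin_continuous_map_preimage[OF _ U] unfolding pathin_def by fastforce
  then obtain W where W: "open W" "{s \<in> {0..1}. \<gamma> s \<in> U} = {0..1} \<inter> W"
    unfolding openin_open by blast
  have "{0..1::real} \<inter> W \<inter> {0<..<1} = W \<inter> {0<..<1}"
    by auto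
  then have "open ?T"
    using open_Int[OF W(1) open_greaterThanLessThan] by (simp only: W(2))
  moreover have "t \<in> ?T"
    using t by simp
  ultimately obtain \<epsilon> where \<epsilon>: "0 < \<epsilon>" "{t - \<epsilon>..t + \<epsilon>} \<subseteq> ?T"
    unfolding open_contains_cball cball_eq_atLeastAtMost by blast
  moreover have "{t - \<epsilon>, t + \<epsilon>} \<subseteq> {t - \<epsilon>..t + \<epsilon>}"
    using \<epsilon>(1) by simp
  ultimately have "t - \<epsilon> \<in> ?T" "t + \<epsilon> \<in> ?T"
    by blast+
  then show thesis
    using that[of "t - \<epsilon>" "t + \<epsilon>"] \<epsilon> by auto
qed

lemma at_most_two_sides_at_arc:
  assumes H: "Hausdorff_space X" and chart: "plane_chart X k"
    and \<gamma>: "pathin X \<gamma>" "inj_on \<gamma> {0..1}" and t: "0 < t" "t < 1" "\<gamma> t \<in> range k"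
  shows "at_most_two_sides_at X (\<gamma> ` {0..1}) (\<gamma> t)"
proof -
  have k: "continuous_map euclidean X k" "open_map euclidean X k"
    using chart by (simp_all add: plane_chart_def)
  obtain a b where ab: "0 < a" "a < t" "t < b" "b < 1" and range: "\<gamma> ` {a..b} \<subseteq> range k"
    using pathin_subinterval_in_open[OF \<gamma>(1) openin_plane_chart_image[OF chart open_UNIV] t] .
  define g where "g = inv k \<circ> \<gamma>"
  have ab01: "{a..b} \<subseteq> {0..1}"
    using ab by auto
  note g = plane_chart_inv_arc[OF chart \<gamma> ab01 range, folded g_def]
  have gt: "k (g t) = \<gamma> t"
    using t(3) by (simp add: g_def f_inv_into_f)
  define R where "R = \<gamma> ` ({0..a} \<union> {b..1})"
  have "{0..1} = {a..b} \<union> ({0..a} \<union> {b..1})"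
    using ab by auto
  then have arc: "\<gamma> ` {0..1} = \<gamma> ` {a..b} \<union> R"
    unfolding R_def by (metis image_Un)
  have "compact ({0..a} \<union> {b..1})"
    by (simp add: compact_Un)
  then have "closedin X R"
    unfolding R_def using ab by (intro closedin_path_image_compact[OF H \<gamma>(1)]) auto
  then have "open (- (k -` R))"
    by (intro open_Compl closed_plane_chart_vimage[OF chart])
  moreover have "\<gamma> t \<notin> R"
    using ab inj_on_image_mem_iff[OF \<gamma>(2), of t "{0..a} \<union> {b..1}"] by (simp add: R_def)
  then have "g t \<in> - (k -` R)"
    using gt by simp
  moreover have "g ` {a..b} \<inter> - (k -` R) = {w. k w \<in> \<gamma> ` {0..1}} \<inter> - (k -` R)"
    unfolding g(3) arc by blast
  ultimately have "at_most_two_sides_at euclidean {w. k w \<in> \<gamma> ` {0..1}} (g t)"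
    using at_most_two_sides_at_cong_open[OF at_most_two_sides_at_plane_arc[OF g(1,2) ab(2,3)]]
    by (metis open_openin)
  then show ?thesis
    using at_most_two_sides_at_open_map_image[OF k, of "g t"] by (simp add: gt)
qed

subsection \<open>Faces of embedded graphs\<close>

lemma face_component:
  assumes "f \<in> faces G X p c"
  shows "f - graph_points G p c
      \<in> connected_components_of (subtopology X (topspace X - graph_points G p c))"
    and "X closure_of (f - graph_points G p c) = f"
  using assms face_minus_graph unfolding faces_def by fastforce+

lemma closedin_face: "f \<in> faces G X p c \<Longrightarrow> closedin X f"
  using closedin_closure_of face_component(2) by metis

lemma face_minus_graph_nonempty: "f \<in> faces G X p c \<Longrightarrow> f - graph_points G p c \<noteq> {}"
  using face_component(1) nonempty_connected_components_of by blast

lemma faces_eqI: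
  assumes "f \<in> faces G X p c" "f' \<in> faces G X p c" "x \<in> f" "x \<in> f'" "x \<notin> graph_points G p c"
  shows "f = f'"
proof -
  have "f - graph_points G p c = f' - graph_points G p c"
    using connected_components_of_overlap[OF assms(1,2)[THEN face_component(1)]] assms(3-5) by blast
  then show ?thesis
    using face_component(2)[OF assms(1)] face_component(2)[OF assms(2)] by metis
qed

lemma connectedin_subset_face:
  assumes "f \<in> faces G X p c" "connectedin X C" "C \<inter> graph_points G p c = {}" "x \<in> f" "x \<in> C"
  shows "C \<subseteq> f"
proof -
  have "connectedin (subtopology X (topspace X - graph_points G p c)) C"
    using assms(2,3) connectedin_subset_topspace[OF assms(2)] by (auto simp: connectedin_subtopology)
  moreover have "\<not> disjnt (f - graph_points G p c) C"
    using assms(3-5) by (auto simp: disjnt_def)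
  ultimately show ?thesis
    using connected_components_of_maximal[OF face_component(1)[OF assms(1)]] by blast
qed

lemma face_meets_open_off_graph:
  assumes "f \<in> faces G X p c" "x \<in> f" "openin X N" "x \<in> N"
  obtains y where "y \<in> f" "y \<in> N" "y \<notin> graph_points G p c"
proof -
  have "x \<in> X closure_of (f - graph_points G p c)"
    using assms(1,2) face_component(2) by metis
  then show thesis
    using that assms(3,4) unfolding in_closure_of by blast
qed

lemma graph_point_in_face_boundary:
  assumes "f \<in> faces G X p c" "x \<in> f" "x \<in> graph_points G p c"
  shows "x \<in> face_boundary G X p c f"
  unfolding face_boundary_def frontier_of_def face_component(2)[OF assms(1)]
  using assms(2,3) interior_of_subset[of X "f - graph_points G p c"] by blast

lemma face_edge_subset_face:
  assumes "f \<in> faces G X p c" "e \<in> face_edges G X p c f"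
  shows "c e ` {0..1} \<subseteq> f"
  using assms(2) face_component(2)[OF assms(1)]
  by (auto simp: face_edges_def face_boundary_def frontier_of_def)

locale embedded_graph =
  fixes G :: "'v sgraph" and X :: "'p topology"
    and p :: "'v \<Rightarrow> 'p" and c :: "'v set \<Rightarrow> real \<Rightarrow> 'p"
  assumes simple: "simple_graph G" and finite_vertices: "finite (gverts G)"
    and surface: "closed_surface X" and embedding: "graph_embedding G X p c"
begin

abbreviation \<Gamma> :: "'p set" where
  "\<Gamma> \<equiv> graph_points G p c"

abbreviation vertex_points :: "'p set" where
  "vertex_points \<equiv> p ` gverts G"

lemma finite_edges: "finite (gedges G)"
  using simple finite_vertices finite_subset[of "gedges G" "Pow (gverts G)"]
  by (auto simp: simple_graph_def)

lemma Hausdorff_surface: "Hausdorff_space X"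
  using surface by (simp add: closed_surface_def)

lemma edge_path:
  assumes "e \<in> gedges G"
  shows "pathin X (c e)" "inj_on (c e) {0..1}" "{c e 0, c e 1} = p ` e"
    "c e ` {0..1} \<inter> vertex_points = p ` e"
  using assms embedding by (simp_all add: graph_embedding_def)

lemma edge_ends_vertex_points:
  assumes "e \<in> gedges G"
  shows "c e 0 \<in> vertex_points" "c e 1 \<in> vertex_points"
  using edge_path(3,4)[OF assms] by blast+

lemma closedin_vertex_points: "closedin X vertex_points"
  using embedding finite_vertices
  by (intro compactin_imp_closedin[OF Hausdorff_surface] finite_imp_compactin)
    (auto simp: graph_embedding_def)

lemma closedin_edges: "E \<subseteq> gedges G \<Longrightarrow> closedin X (\<Union>e\<in>E. c e ` {0..1})"
  using finite_subset[OF _ finite_edges] edge_path(1)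
  by (intro closedin_Union) (auto intro!: closedin_path_image_compact[OF Hausdorff_surface])

lemma closedin_graph_points: "closedin X \<Gamma>"
  unfolding graph_points_def using closedin_vertex_points closedin_edges[of "gedges G"] by blast

lemma edge_interior_not_vertex:
  assumes e: "e \<in> gedges G" and t: "0 < t" "t < 1"
  shows "c e t \<notin> vertex_points"
proof -
  have "c e t \<noteq> c e 0" "c e t \<noteq> c e 1"
    using inj_on_eq_iff[OF edge_path(2)[OF e]] t by simp_all
  then have "c e t \<notin> p ` e"
    unfolding edge_path(3)[OF e, symmetric] by simp
  moreover have "c e t \<in> c e ` {0..1}"
    using t by simp
  ultimately show ?thesis
    using edge_path(4)[OF e] by blast
qed

lemma edge_interior_not_other_edge:
  assumes e: "e \<in> gedges G" "e' \<in> gedges G" "e' \<noteq> e" and t: "0 < t" "t < 1"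
  shows "c e t \<notin> c e' ` {0..1}"
proof
  assume "c e t \<in> c e' ` {0..1}"
  moreover have "c e t \<in> c e ` {0..1}"
    using t by simp
  moreover have "c e ` {0..1} \<inter> c e' ` {0..1} \<subseteq> p ` (e \<inter> e')"
    using embedding e unfolding graph_embedding_def by metis
  ultimately have "c e t \<in> p ` e"
    by blast
  then show False
    using edge_path(4)[OF e(1)] edge_interior_not_vertex[OF e(1) t] by blast
qed

lemma edge_interior_neighbourhood:
  assumes e: "e \<in> gedges G" and t: "0 < t" "t < 1"
  obtains V where "openin X V" "c e t \<in> V" "c e ` {0..1} \<inter> V = \<Gamma> \<inter> V"
proof -
  define R where "R = vertex_points \<union> (\<Union>e'\<in>gedges G - {e}. c e' ` {0..1})"
  have "closedin X R"
    unfolding R_def by (intro closedin_Un closedin_vertex_points closedin_edges Diff_subset)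
  then have "openin X (topspace X - R)"
    by (simp add: openin_diff)
  moreover have "c e t \<in> topspace X"
    using path_image_subset_topspace[OF edge_path(1)[OF e]] t by auto
  then have "c e t \<in> topspace X - R"
    using edge_interior_not_vertex[OF e t] edge_interior_not_other_edge[OF e _ _ t]
    by (simp add: R_def)
  moreover have "(\<Union>e'\<in>gedges G. c e' ` {0..1}) = c e ` {0..1} \<union> (\<Union>e'\<in>gedges G - {e}. c e' ` {0..1})"
    by (subst insert_Diff[OF e, symmetric]) (rule UN_insert)
  then have "\<Gamma> = c e ` {0..1} \<union> R"
    unfolding graph_points_def R_def by (simp only: Un_ac)
  then have "c e ` {0..1} \<inter> (topspace X - R) = \<Gamma> \<inter> (topspace X - R)"
    by (simp only: Int_Un_distrib2 Diff_disjoint Un_empty_right)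
  ultimately show thesis
    by (rule that)
qed

lemma at_most_two_sides_at_edge_interior:
  assumes e: "e \<in> gedges G" and t: "0 < t" "t < 1"
  shows "at_most_two_sides_at X \<Gamma> (c e t)"
proof -
  obtain V where V: "openin X V" "c e t \<in> V" "c e ` {0..1} \<inter> V = \<Gamma> \<inter> V"
    using edge_interior_neighbourhood[OF e t] .
  obtain k where k: "plane_chart X k" "c e t \<in> range k"
    using closed_surface_chart[OF surface] V(1,2) openin_subset by blast
  have "at_most_two_sides_at X (c e ` {0..1}) (c e t)"
    using at_most_two_sides_at_arc[OF Hausdorff_surface k(1) edge_path(1,2)[OF e] t k(2)] .
  then show ?thesis
    using V by (rule at_most_two_sides_at_cong_open)
qed

lemma openin_face_minus_graph:
  assumes "f \<in> faces G X p c"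
  shows "openin X (f - \<Gamma>)"
  using locally_connected_closed_surface[OF surface] closedin_graph_points face_component(1)[OF assms]
  unfolding locally_connected_space_open_connected_components by blast

lemma faces_on_edge_cover_neighbourhood:
  assumes f: "f \<in> faces G X p c" "e \<in> face_edges G X p c f"
    and f': "f' \<in> faces G X p c" "e \<in> face_edges G X p c f'"
    and "f \<noteq> f'" and t: "0 < t" "t < 1"
  shows "c e t \<in> X interior_of (f \<union> f')"
proof -
  have e: "e \<in> gedges G"
    using f(2) by (simp add: face_edges_def)
  have x: "c e t \<in> f" "c e t \<in> f'"
    using face_edge_subset_face[OF f] face_edge_subset_face[OF f'] t by auto
  obtain V where V: "openin X V" "c e t \<in> V" "c e ` {0..1} \<inter> V = \<Gamma> \<inter> V"
    using edge_interior_neighbourhood[OF e t] .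
  obtain N A B where N: "openin X N" "c e t \<in> N" "N \<subseteq> V" "N - \<Gamma> \<subseteq> A \<union> B"
    and AB: "connectedin X A" "connectedin X B" "A \<union> B \<subseteq> V - \<Gamma>"
    using at_most_two_sides_at_edge_interior[OF e t] V(1,2) unfolding at_most_two_sides_at_def by meson
  obtain y where y: "y \<in> f" "y \<in> N" "y \<notin> \<Gamma>"
    using face_meets_open_off_graph[OF f(1) x(1) N(1,2)] .
  obtain y' where y': "y' \<in> f'" "y' \<in> N" "y' \<notin> \<Gamma>"
    using face_meets_open_off_graph[OF f'(1) x(2) N(1,2)] .
  have "y' \<notin> f"
    using faces_eqI[OF f(1) f'(1) _ y'(1,3)] \<open>f \<noteq> f'\<close> by blast
  moreover have "D \<subseteq> f" if "y \<in> D" "D = A \<or> D = B" for D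
    using that AB by (intro connectedin_subset_face[OF f(1) _ _ y(1)]) auto
  moreover have "D \<subseteq> f'" if "y' \<in> D" "D = A \<or> D = B" for D
    using that AB by (intro connectedin_subset_face[OF f'(1) _ _ y'(1)]) auto
  moreover have "y \<in> A \<union> B" "y' \<in> A \<union> B"
    using y y' N(4) by blast+
  ultimately have "A \<union> B \<subseteq> f \<union> f'"
    by blast
  then have "N \<subseteq> f \<union> f'"
    using N(3,4) V(3) face_edge_subset_face[OF f] by blast
  then show ?thesis
    using N(1,2) unfolding interior_of_def by blast
qed

lemma even_face_graph_point_on_edge:
  assumes f: "even_face G X p c f" and x: "x \<in> f" "x \<in> \<Gamma>" "x \<notin> vertex_points"
  obtains e t where "e \<in> face_edges G X p c f" "0 < t" "t < 1" "x = c e t"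
proof -
  obtain vs where vs: "is_cycle G vs" "face_boundary G X p c f = (\<Union>e\<in>cycle_edges vs. c e ` {0..1})"
    and face: "f \<in> faces G X p c"
    using f by (auto simp: even_face_def)
  have "x \<in> face_boundary G X p c f"
    using graph_point_in_face_boundary[OF face x(1,2)] .
  then obtain e where e: "e \<in> face_edges G X p c f" "x \<in> c e ` {0..1}"
    unfolding vs(2) face_edges_eq_cycle_edges[OF embedding vs] by blast
  then obtain t where t: "t \<in> {0..1}" "x = c e t"
    by blast
  have "e \<in> gedges G"
    using e(1) by (simp add: face_edges_def)
  then have "t \<noteq> 0" "t \<noteq> 1"
    using edge_ends_vertex_points x(3) t(2) by blast+
  then show thesis
    using that[OF e(1), of t] t by simp
qed

definition edges_doubly_covered :: "'p set set \<Rightarrow> bool" where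
  "edges_doubly_covered S \<longleftrightarrow>
    (\<forall>f\<in>S. \<forall>e\<in>face_edges G X p c f. \<exists>f'\<in>S. f' \<noteq> f \<and> e \<in> face_edges G X p c f')"

lemma doubly_covered_faces_interior:
  assumes S: "\<forall>f\<in>S. even_face G X p c f"
    and cover: "edges_doubly_covered S"
  shows "\<Union>S - vertex_points \<subseteq> X interior_of \<Union>S"
proof
  fix x assume x: "x \<in> \<Union>S - vertex_points"
  then obtain f where f: "f \<in> S" "x \<in> f"
    by blast
  have S_faces: "S \<subseteq> faces G X p c"
    using S by (auto simp: even_face_def)
  show "x \<in> X interior_of \<Union>S"
  proof (cases "x \<in> \<Gamma>")
    case True
    then obtain e t where e: "e \<in> face_edges G X p c f" and t: "0 < t" "t < 1" "x = c e t"
      using even_face_graph_point_on_edge[of f x] S f x by blast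
    obtain f' where "f' \<in> S" "f' \<noteq> f" "e \<in> face_edges G X p c f'"
      using cover f(1) e unfolding edges_doubly_covered_def by blast
    then have "x \<in> X interior_of (f \<union> f')" "f \<union> f' \<subseteq> \<Union>S"
      using faces_on_edge_cover_neighbourhood[of f e f' t] S_faces f(1) e t by auto
    then show ?thesis
      using interior_of_mono by blast
  next
    case False
    have "openin X (f - \<Gamma>)" "f - \<Gamma> \<subseteq> \<Union>S"
      using openin_face_minus_graph S_faces f(1) by blast+
    then show ?thesis
      using False f(2) unfolding interior_of_def by blast
  qed
qed

text \<open>Two-sidedness of the edges only makes \<open>\<Union>S\<close> open off the vertices. Openness at the vertices
  comes from the fact that finitely many points do not separate the plane.\<close>

lemma doubly_covered_faces_eq_faces:
  assumes S: "finite S" "S \<noteq> {}" "\<forall>f\<in>S. even_face G X p c f"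
    and cover: "edges_doubly_covered S"
  shows "S = faces G X p c"
proof
  show S_faces: "S \<subseteq> faces G X p c"
    using S(3) by (auto simp: even_face_def)
  have "\<Union>S = topspace X"
  proof (rule closedin_open_off_finite_eq_topspace[OF surface])
    show "closedin X (\<Union>S)"
      using S(1) S_faces closedin_face by (intro closedin_Union) blast+
    show "\<Union>S \<noteq> {}"
      using S(2) S_faces face_minus_graph_nonempty by blast
    show "finite vertex_points"
      using finite_vertices by simp
    show "\<Union>S - vertex_points \<subseteq> X interior_of \<Union>S"
      using doubly_covered_faces_interior[OF S(3) cover] .
    have "f \<subseteq> X closure_of (\<Union>S - vertex_points)" if "f \<in> S" for f
    proof -
      have "f - \<Gamma> \<subseteq> \<Union>S - vertex_points"
        using that by (auto simp: graph_points_def)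
      then have "X closure_of (f - \<Gamma>) \<subseteq> X closure_of (\<Union>S - vertex_points)"
        by (rule closure_of_mono)
      then show ?thesis
        using face_component(2) S_faces that by (metis subsetD)
    qed
    then show "\<Union>S \<subseteq> X closure_of (\<Union>S - vertex_points)"
      by blast
  qed
  show "faces G X p c \<subseteq> S"
  proof
    fix f0 assume f0: "f0 \<in> faces G X p c"
    then obtain y where y: "y \<in> f0" "y \<notin> \<Gamma>"
      using face_minus_graph_nonempty by blast
    then obtain f where "f \<in> S" "y \<in> f"
      using closedin_subset[OF closedin_face[OF f0]] \<open>\<Union>S = topspace X\<close> by blast
    then show "f0 \<in> S"
      using faces_eqI[OF f0 _ y(1) _ y(2)] S_faces by blast
  qed
qed

end

subsection \<open>Sums of sets modulo two\<close>

definition sum_mod2 :: "('i \<Rightarrow> 'e set) \<Rightarrow> 'i set \<Rightarrow> 'e set" where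
  "sum_mod2 E S = {e. odd (card {i \<in> S. e \<in> E i})}"

definition independent_mod2 :: "('i \<Rightarrow> 'e set) \<Rightarrow> 'i set \<Rightarrow> bool" where
  "independent_mod2 E I \<longleftrightarrow> (\<forall>S. finite S \<and> S \<subseteq> I \<and> S \<noteq> {} \<longrightarrow> sum_mod2 E S \<noteq> {})"

lemma odd_card_sym_diff:
  assumes "finite A" "finite B"
  shows "odd (card (sym_diff A B)) \<longleftrightarrow> odd (card A) \<noteq> odd (card B)"
proof -
  have "card A = card (A - B) + card (A \<inter> B)"
    using card_Int_Diff[OF assms(1), of B] by simp
  moreover have "card B = card (B - A) + card (A \<inter> B)"
    using card_Int_Diff[OF assms(2), of A] by (simp add: Int_commute)
  moreover have "card (sym_diff A B) = card (A - B) + card (B - A)"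
    using assms by (intro card_Un_disjoint) auto
  ultimately show ?thesis
    by presburger
qed

lemma sum_mod2_empty: "sum_mod2 E {} = {}"
  by (simp add: sum_mod2_def)

lemma sum_mod2_singleton: "sum_mod2 E {i} = E i"
proof -
  have "{j \<in> {i}. e \<in> E j} = (if e \<in> E i then {i} else {})" for e
    by auto
  then show ?thesis
    by (simp add: sum_mod2_def)
qed

lemma sum_mod2_sym_diff:
  assumes "finite S" "finite T"
  shows "sum_mod2 E (sym_diff S T) = sym_diff (sum_mod2 E S) (sum_mod2 E T)"
proof -
  have "{i \<in> sym_diff S T. e \<in> E i} = sym_diff {i \<in> S. e \<in> E i} {i \<in> T. e \<in> E i}" for e
    by blast
  then show ?thesis
    using assms by (auto simp: sum_mod2_def odd_card_sym_diff)
qed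

lemma independent_mod2_sum_eqD:
  assumes "independent_mod2 E I" "finite S" "finite T" "S \<subseteq> I" "T \<subseteq> I" "sum_mod2 E S = sum_mod2 E T"
  shows "S = T"
proof -
  have "sum_mod2 E (sym_diff S T) = {}"
    using assms by (simp add: sum_mod2_sym_diff)
  then have "sym_diff S T = {}"
    using assms unfolding independent_mod2_def
    by (metis Diff_subset Un_least finite_Diff finite_Un subset_trans)
  then show ?thesis
    by blast
qed

lemma independent_mod2_finite:
  assumes indep: "independent_mod2 E I" and "finite B" "\<And>i. i \<in> I \<Longrightarrow> E i \<subseteq> B"
  shows "finite I"
proof (rule finite_imageD)
  show "finite (E ` I)"
    using assms(2,3) by (intro finite_subset[of "E ` I" "Pow B"]) auto
  have "{i} = {j}" if "i \<in> I" "j \<in> I" "E i = E j" for i j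
    using that by (intro independent_mod2_sum_eqD[OF indep]) (simp_all add: sum_mod2_singleton)
  then show "inj_on E I"
    by (auto intro: inj_onI)
qed

lemma sum_mod2_eq_generator_iff_card_1:
  assumes "independent_mod2 E I" "finite S" "S \<subseteq> I"
  shows "(\<exists>i\<in>I. sum_mod2 E S = E i) \<longleftrightarrow> card S = 1"
proof -
  have "sum_mod2 E S = E i \<longleftrightarrow> S = {i}" if "i \<in> I" for i
    using independent_mod2_sum_eqD[OF assms(1,2) _ assms(3), of "{i}"] that
    by (auto simp: sum_mod2_singleton)
  then have "(\<exists>i\<in>I. sum_mod2 E S = E i) \<longleftrightarrow> (\<exists>i. S = {i})"
    using assms(3) by auto
  then show ?thesis
    by (simp add: card_1_singleton_iff)
qed

subsection \<open>Induced cubical graphs\<close>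

lemma adjacent_hypercube:
  "adjacent (hypercube n) a b \<longleftrightarrow>
    length a = n \<and> length b = n \<and> card {i. i < n \<and> a ! i \<noteq> b ! i} = 1"
proof -
  have "{i. i < n \<and> a ! i \<noteq> b ! i} = {i. i < n \<and> b ! i \<noteq> a ! i}" for a b :: "bool list"
    by auto
  then show ?thesis
    by (auto simp: adjacent_def hypercube_def doubleton_eq_iff)
qed

lemma card_indices_of_subset:
  assumes "distinct xs" "A \<subseteq> set xs"
  shows "card {i. i < length xs \<and> xs ! i \<in> A} = card A"
proof -
  have "card {i. i < length xs \<and> xs ! i \<in> A} = length (filter (\<lambda>x. x \<in> A) xs)"
    by (simp only: length_filter_conv_card)
  also have "\<dots> = card (set (filter (\<lambda>x. x \<in> A) xs))"
    using assms(1) by (intro distinct_card[symmetric] distinct_filter)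
  also have "set (filter (\<lambda>x. x \<in> A) xs) = A"
    using assms(2) by auto
  finally show ?thesis .
qed

lemma induced_cubical_if_set_labelling:
  assumes "finite F" and \<sigma>: "inj_on \<sigma> (gverts H)" "\<sigma> ` gverts H \<subseteq> Pow F"
    and adj: "\<And>x y. x \<in> gverts H \<Longrightarrow> y \<in> gverts H \<Longrightarrow> adjacent H x y \<longleftrightarrow> card (sym_diff (\<sigma> x) (\<sigma> y)) = 1"
  shows "induced_cubical H"
proof -
  obtain fs where fs: "set fs = F" "distinct fs"
    using \<open>finite F\<close> finite_distinct_list by blast
  \<comment> \<open>The last, constant, coordinate ensures \<open>n \<ge> 1\<close> when \<open>F\<close> is empty.\<close>
  define n where "n = Suc (length fs)"
  define l where "l x = map (\<lambda>f. f \<in> \<sigma> x) fs @ [False]" for x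
  have sub: "\<sigma> x \<subseteq> set fs" if "x \<in> gverts H" for x
    using \<sigma>(2) fs(1) that by blast
  have "inj_on l (gverts H)"
  proof (rule inj_onI)
    fix x y assume xy: "x \<in> gverts H" "y \<in> gverts H" "l x = l y"
    then have "\<forall>f\<in>set fs. f \<in> \<sigma> x \<longleftrightarrow> f \<in> \<sigma> y"
      by (simp add: l_def map_eq_conv)
    then have "\<sigma> x = \<sigma> y"
      using sub xy(1,2) by blast
    then show "x = y"
      using \<sigma>(1) xy(1,2) by (simp add: inj_on_eq_iff)
  qed
  moreover have "l ` gverts H \<subseteq> gverts (hypercube n)"
    by (auto simp: l_def n_def hypercube_def)
  moreover have "adjacent (hypercube n) (l x) (l y) \<longleftrightarrow> adjacent H x y"
    if "x \<in> gverts H" "y \<in> gverts H" for x y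
  proof -
    have "{i. i < n \<and> l x ! i \<noteq> l y ! i} = {i. i < length fs \<and> fs ! i \<in> sym_diff (\<sigma> x) (\<sigma> y)}"
      by (auto simp: l_def n_def nth_append less_Suc_eq)
    moreover have "sym_diff (\<sigma> x) (\<sigma> y) \<subseteq> set fs"
      using sub[OF that(1)] sub[OF that(2)] by blast
    ultimately have "card {i. i < n \<and> l x ! i \<noteq> l y ! i} = card (sym_diff (\<sigma> x) (\<sigma> y))"
      using card_indices_of_subset[OF fs(2)] by (simp only:)
    then show ?thesis
      using adj[OF that] by (simp add: adjacent_hypercube l_def n_def)
  qed
  ultimately show ?thesis
    unfolding induced_cubical_def by (intro exI[of _ n]) (auto simp: n_def)
qed

lemma connected_sym_diff_eq_sum_mod2:
  assumes step: "\<And>A B. adjacent R A B \<Longrightarrow> \<exists>f\<in>F. sym_diff A B = E f"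
    and "(adjacent R)\<^sup>*\<^sup>* A B"
  shows "\<exists>S. finite S \<and> S \<subseteq> F \<and> sym_diff A B = sum_mod2 E S"
  using assms(2)
proof (induction rule: rtranclp_induct)
  case base
  show ?case
    by (intro exI[of _ "{}"]) (simp add: sum_mod2_empty)
next
  case (step B C)
  obtain S where S: "finite S" "S \<subseteq> F" "sym_diff A B = sum_mod2 E S"
    using step.IH by blast
  obtain f where f: "f \<in> F" "sym_diff B C = E f"
    using assms(1)[OF step.hyps(2)] by blast
  have "sym_diff A C = sym_diff (sym_diff A B) (sym_diff B C)"
    by blast
  also have "\<dots> = sum_mod2 E (sym_diff S {f})"
    using S f by (simp add: sum_mod2_sym_diff sum_mod2_singleton)
  finally show ?case
    using S(1,2) f(1) by (intro exI[of _ "sym_diff S {f}"]) auto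
qed

lemma component_sum_mod2_labelling:
  assumes "finite F" and step: "\<And>A B. adjacent R A B \<Longrightarrow> \<exists>f\<in>F. sym_diff A B = E f"
    and "H \<in> graph_components R"
  obtains \<sigma> where "\<sigma> ` gverts H \<subseteq> Pow F"
    "\<And>A B. A \<in> gverts H \<Longrightarrow> B \<in> gverts H \<Longrightarrow> sym_diff A B = sum_mod2 E (sym_diff (\<sigma> A) (\<sigma> B))"
proof -
  obtain M where H: "H = induced_subgraph R {A. (adjacent R)\<^sup>*\<^sup>* M A}"
    using assms(3) unfolding graph_components_def by blast
  have "\<exists>S. S \<subseteq> F \<and> sym_diff M A = sum_mod2 E S" if "(adjacent R)\<^sup>*\<^sup>* M A" for A
    using connected_sym_diff_eq_sum_mod2[OF step that] by metis
  then have "\<forall>A\<in>gverts H. \<exists>S. S \<subseteq> F \<and> sym_diff M A = sum_mod2 E S"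
    by (simp add: H induced_subgraph_def)
  then obtain \<sigma> where \<sigma>: "\<And>A. A \<in> gverts H \<Longrightarrow> \<sigma> A \<subseteq> F"
    "\<And>A. A \<in> gverts H \<Longrightarrow> sym_diff M A = sum_mod2 E (\<sigma> A)"
    by metis
  have finite: "finite (\<sigma> A)" if "A \<in> gverts H" for A
    using \<sigma>(1)[OF that] \<open>finite F\<close> finite_subset by blast
  have "sym_diff A B = sum_mod2 E (sym_diff (\<sigma> A) (\<sigma> B))" if "A \<in> gverts H" "B \<in> gverts H" for A B
  proof -
    have "sym_diff A B = sym_diff (sym_diff M A) (sym_diff M B)"
      by blast
    then show ?thesis
      by (simp only: \<sigma>(2) that sum_mod2_sym_diff finite)
  qed
  then show thesis
    using that[of \<sigma>] \<sigma>(1) by blast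
qed

lemma induced_cubical_component:
  fixes R :: "'e set sgraph" and E :: "'f \<Rightarrow> 'e set"
  assumes "finite F" and indep: "independent_mod2 E F"
    and adj: "\<And>A B. adjacent R A B \<longleftrightarrow> A \<in> gverts R \<and> B \<in> gverts R \<and> (\<exists>f\<in>F. sym_diff A B = E f)"
    and H: "H \<in> graph_components R"
  shows "induced_cubical H"
proof -
  have "\<exists>f\<in>F. sym_diff A B = E f" if "adjacent R A B" for A B
    using adj[of A B] that by blast
  then obtain \<sigma> where \<sigma>: "\<sigma> ` gverts H \<subseteq> Pow F"
    and diff: "\<And>A B. A \<in> gverts H \<Longrightarrow> B \<in> gverts H \<Longrightarrow> sym_diff A B = sum_mod2 E (sym_diff (\<sigma> A) (\<sigma> B))"
    using component_sum_mod2_labelling[OF \<open>finite F\<close> _ H] by metis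
  show ?thesis
  proof (rule induced_cubical_if_set_labelling[OF \<open>finite F\<close> _ \<sigma>])
    show "inj_on \<sigma> (gverts H)"
    proof (rule inj_onI)
      fix A B assume "A \<in> gverts H" "B \<in> gverts H" "\<sigma> A = \<sigma> B"
      then have "sym_diff A B = {}"
        using diff by (simp add: sum_mod2_empty)
      then show "A = B"
        by blast
    qed
    fix A B assume AB: "A \<in> gverts H" "B \<in> gverts H"
    then have "adjacent H A B \<longleftrightarrow> (\<exists>f\<in>F. sym_diff A B = E f)"
      using H adj[of A B] by (auto simp: graph_components_def adjacent_def induced_subgraph_def)
    also have "\<dots> \<longleftrightarrow> (\<exists>f\<in>F. sum_mod2 E (sym_diff (\<sigma> A) (\<sigma> B)) = E f)"
      by (simp only: diff[OF AB])
    also have "\<dots> \<longleftrightarrow> card (sym_diff (\<sigma> A) (\<sigma> B)) = 1"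
    proof (rule sum_mod2_eq_generator_iff_card_1[OF indep])
      show "sym_diff (\<sigma> A) (\<sigma> B) \<subseteq> F"
        using AB \<sigma> by blast
      then show "finite (sym_diff (\<sigma> A) (\<sigma> B))"
        using \<open>finite F\<close> by (rule finite_subset)
    qed
    finally show "adjacent H A B \<longleftrightarrow> card (sym_diff (\<sigma> A) (\<sigma> B)) = 1" .
  qed
qed

subsection \<open>Resonance graphs\<close>

lemma (in embedded_graph) independent_mod2_face_edges:
  assumes "\<forall>f\<in>F. even_face G X p c f" "F \<noteq> faces G X p c"
  shows "independent_mod2 (face_edges G X p c) F"
  unfolding independent_mod2_def
proof (intro allI impI notI)
  fix S assume S: "finite S \<and> S \<subseteq> F \<and> S \<noteq> {}" and "sum_mod2 (face_edges G X p c) S = {}"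
  then have even: "even (card {f \<in> S. e \<in> face_edges G X p c f})" for e
    by (auto simp: sum_mod2_def)
  have "edges_doubly_covered S"
    unfolding edges_doubly_covered_def
  proof (intro ballI, rule ccontr)
    fix f e assume "f \<in> S" "e \<in> face_edges G X p c f"
      and "\<not> (\<exists>f'\<in>S. f' \<noteq> f \<and> e \<in> face_edges G X p c f')"
    then have "{f \<in> S. e \<in> face_edges G X p c f} = {f}"
      by blast
    then show False
      using even[of e] by simp
  qed
  then have "S = faces G X p c"
    using S assms(1) by (intro doubly_covered_faces_eq_faces) auto
  then show False
    using S assms by (auto simp: even_face_def)
qed

lemma adjacent_resonance_graph:
  "adjacent (resonance_graph G X p c F) A B \<longleftrightarrow>
    A \<in> gverts (resonance_graph G X p c F) \<and> B \<in> gverts (resonance_graph G X p c F) \<and>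
    (\<exists>f\<in>F. sym_diff A B = face_edges G X p c f)"
  unfolding adjacent_def resonance_graph_def by (auto simp: doubleton_eq_iff Un_commute)

theorem theorem1p2:
  fixes G :: "'v sgraph" and X :: "'p topology"
    and p :: "'v \<Rightarrow> 'p" and c :: "'v set \<Rightarrow> real \<Rightarrow> 'p"
    and F :: "'p set set" and H :: "'v set set sgraph"
  assumes "simple_graph G" and "finite (gverts G)"
    and "closed_surface X"
    and "graph_embedding G X p c"
    and "\<forall>f\<in>F. even_face G X p c f"
    and "F \<noteq> faces G X p c"
    and "H \<in> graph_components (resonance_graph G X p c F)"
  shows "induced_cubical H"
proof -
  interpret embedded_graph G X p c
    using assms(1-4) by unfold_locales
  have indep: "independent_mod2 (face_edges G X p c) F"
    using assms(5,6) by (rule independent_mod2_face_edges)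
  have "finite F"
    using indep finite_edges by (rule independent_mod2_finite) (simp add: face_edges_def)
  then show ?thesis
    using indep adjacent_resonance_graph assms(7) by (rule induced_cubical_component)
qed

end
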